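(* Let $X$ be a real Banach space and let $\partial$ be a feasible subdifferential (on $X$). Let $f:X\to\mathbb{R}\cup\{+\infty\}$ be a proper lower semicontinuous function. Let $(x_0,x_0^* )\in X\times X^*$ be in monotone relation to $\partial f$, that is, $$\langle x^*-x_0^*,x-x_0\rangle\ge 0\quad\text{for all }(x,x^* )\in\partial f.$$ Then $(x_0,x_0^* )\in\partial^c f$, i.e. $x_0^*\in\partial^c f(x_0)$.
   Context: $X$ is a real Banach space with dual $X^*$ and duality pairing $\langle\cdot,\cdot\rangle$. For $f:X\to\mathbb{R}\cup\{+\infty\}$, $\operatorname{dom} f=\{x\in X: f(x)<+\infty\}$, and $f$ is proper if $\operatorname{dom} f\neq\emptyset$. Feasible subdifferential: a multi-valued operator $\partial$ which associates to any function $f:X\to\mathbb{R}\cup\{+\infty\}$ and any $x\in X$ a (possibly empty) subset $\partial f(x)\subset X^*$ is called a feasible subdifferential if (P1) $\partial f(x)=\{x^*\in X^*: \langle x^*,y-x\rangle\le f(y)-f(x)\ \ \forall y\in U\}$ (the Fenchel subdifferential $\partial^c f(x)$) whenever $f$ is a convex and continuous function in a neighbourhood $U$ of $x$; (P2) for $f$ lower semicontinuous and $g$ convex and continuous in a neighbourhood of $x\in\operatorname{dom} f$, one has $$0\in\partial g(x)+\limsup_{y\to x,\ f(y)\to f(x)}\partial f(y)$$ whenever $x$ is a local minimum point of $f+g$. In detail this means: there are sequences $(y_n)$ in $X$ and $y_n^*\in\partial f(y_n)$ such that $y_n\to x$ in norm, $f(y_n)\to f(x)$, and $(y_n^* )$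 converges in the weak-star topology to some $y^*$ with $-y^*\in\partial g(x)$. A map $\partial f:X\rightrightarrows X^*$ is identified with its graph: $(x,x^* )\in\partial f$ means $x^*\in\partial f(x)$ (and similarly for $\partial^c f$). For a general proper function $f:X\to\mathbb{R}\cup\{+\infty\}$ the Fenchel subdifferential is the global one: for $x\in\operatorname{dom} f$, $\partial^c f(x)=\{x^*\in X^*: \langle x^*,y-x\rangle\le f(y)-f(x)\ \ \forall y\in X\}$, and $\partial^c f(x)=\emptyset$ for $x\notin\operatorname{dom} f$. *)

theory Defs
  imports "HOL-Analysis.Analysis"
begin

(* Functions from 'a to R \<union> {+\<infinity>} are ereal-valued functions that never take the value -\<infinity>. *)
definition never_minus_infinity :: "('a \<Rightarrow> ereal) \<Rightarrow> bool" where
  "never_minus_infinity f \<longleftrightarrow> (\<forall>x. f x \<noteq> -\<infinity>)"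

definition effective_domain :: "('a \<Rightarrow> ereal) \<Rightarrow> 'a set" where
  "effective_domain f = {x. f x < \<infinity>}"

definition proper_function :: "('a \<Rightarrow> ereal) \<Rightarrow> bool" where
  "proper_function f \<longleftrightarrow> never_minus_infinity f \<and> effective_domain f \<noteq> {}"

definition lower_semicontinuous :: "('a::topological_space \<Rightarrow> ereal) \<Rightarrow> bool" where
  "lower_semicontinuous f \<longleftrightarrow> (\<forall>x a. a < f x \<longrightarrow> (\<forall>\<^sub>F y in nhds x. a < f y))"

(* convex_on includes the convexity of U. A function that is convex and continuous near a point
   is taken to be finite there, so that real_of_ereal loses no information on U. *)
definition convex_continuous_near ::
    "'a::real_normed_vector set \<Rightarrow> 'a \<Rightarrow> ('a \<Rightarrow> ereal) \<Rightarrow> bool" where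
  "convex_continuous_near U x f \<longleftrightarrow>
     x \<in> interior U \<and> (\<forall>y\<in>U. \<bar>f y\<bar> \<noteq> \<infinity>) \<and>
     convex_on U (\<lambda>y. real_of_ereal (f y)) \<and> continuous_on U f"

(* Only meaningful when f x is finite. *)
definition fenchel_subdifferential_on ::
    "'a::real_normed_vector set \<Rightarrow> ('a \<Rightarrow> ereal) \<Rightarrow> 'a \<Rightarrow> ('a \<Rightarrow>\<^sub>L real) set" where
  "fenchel_subdifferential_on U f x =
     {xs. \<forall>y\<in>U. ereal (blinfun_apply xs (y - x)) \<le> f y - f x}"

definition fenchel_subdifferential ::
    "('a::real_normed_vector \<Rightarrow> ereal) \<Rightarrow> 'a \<Rightarrow> ('a \<Rightarrow>\<^sub>L real) set" where
  "fenchel_subdifferential f x =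
     (if x \<in> effective_domain f then fenchel_subdifferential_on UNIV f x else {})"

definition local_minimum :: "('a::topological_space \<Rightarrow> ereal) \<Rightarrow> 'a \<Rightarrow> bool" where
  "local_minimum h x \<longleftrightarrow> (\<forall>\<^sub>F y in nhds x. h x \<le> h y)"

type_synonym 'a subdifferential = "('a \<Rightarrow> ereal) \<Rightarrow> 'a \<Rightarrow> ('a \<Rightarrow>\<^sub>L real) set"

(* For real-valued functionals the strong operator topology, i.e. the topology of pointwise
   convergence, is the weak-star topology of the dual space. *)
abbreviation weak_star_topology :: "('a::real_normed_vector \<Rightarrow>\<^sub>L real) topology" where
  "weak_star_topology \<equiv> strong_operator_topology"

(* The upper limit of D f y as y \<rightarrow> x and f y \<rightarrow> f x, taken along sequences. *)
definition limsup_subdifferential ::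
    "'a::real_normed_vector subdifferential \<Rightarrow> ('a \<Rightarrow> ereal) \<Rightarrow> 'a \<Rightarrow> ('a \<Rightarrow>\<^sub>L real) set" where
  "limsup_subdifferential D f x =
     {ys. \<exists>y yn. (\<forall>n::nat. yn n \<in> D f (y n)) \<and> y \<longlonglongrightarrow> x \<and> (\<lambda>n. f (y n)) \<longlonglongrightarrow> f x \<and>
        limitin weak_star_topology yn ys sequentially}"

(* The sum in the second condition is the Minkowski sum of sets. *)
definition feasible_subdifferential :: "'a::real_normed_vector subdifferential \<Rightarrow> bool" where
  "feasible_subdifferential D \<longleftrightarrow>
     (\<forall>f x U. never_minus_infinity f \<and> convex_continuous_near U x f \<longrightarrow>
        D f x = fenchel_subdifferential_on U f x) \<and>
     (\<forall>f g x U. never_minus_infinity f \<and> never_minus_infinity g \<and>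
        lower_semicontinuous f \<and> x \<in> effective_domain f \<and> convex_continuous_near U x g \<and>
        local_minimum (\<lambda>y. f y + g y) x \<longrightarrow>
        0 \<in> D g x + limsup_subdifferential D f x)"

definition in_monotone_relation ::
    "'a::real_normed_vector \<Rightarrow> ('a \<Rightarrow>\<^sub>L real) \<Rightarrow> ('a \<Rightarrow> ('a \<Rightarrow>\<^sub>L real) set) \<Rightarrow> bool" where
  "in_monotone_relation x0 x0s T \<longleftrightarrow>
     (\<forall>x xs. xs \<in> T x \<longrightarrow> blinfun_apply (xs - x0s) (x - x0) \<ge> 0)"

lemma limitin_weak_star_iff:
  "limitin weak_star_topology F l net \<longleftrightarrow>
     (\<forall>v. ((\<lambda>n. blinfun_apply (F n) v) \<longlongrightarrow> blinfun_apply l v) net)"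
proof
  assume L: "limitin weak_star_topology F l net"
  show "\<forall>v. ((\<lambda>n. blinfun_apply (F n) v) \<longlongrightarrow> blinfun_apply l v) net"
  proof
    fix v
    have "limitin euclidean ((\<lambda>f. blinfun_apply f v) \<circ> F) (blinfun_apply l v) net"
      by (rule continuous_map_limit[OF strong_operator_topology_continuous_evaluation L])
    then show "((\<lambda>n. blinfun_apply (F n) v) \<longlongrightarrow> blinfun_apply l v) net"
      by (simp add: o_def)
  qed
next
  assume R: "\<forall>v. ((\<lambda>n. blinfun_apply (F n) v) \<longlongrightarrow> blinfun_apply l v) net"
  have lim: "((\<lambda>n. blinfun_apply (F n)) \<longlongrightarrow> blinfun_apply l) net"
    using R unfolding limitin_canonical_iff[symmetric] euclidean_product_topology[symmetric]
    by (subst limitin_componentwise) (auto simp: euclidean_product_topology)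
  show "limitin weak_star_topology F l net"
    unfolding limitin_def
  proof (intro conjI allI impI)
    show "l \<in> topspace weak_star_topology"
      by (simp add: strong_operator_topology_topspace)
  next
    fix U assume U: "openin weak_star_topology U \<and> l \<in> U"
    then obtain V where V: "open V" "U = blinfun_apply -` V"
      unfolding strong_operator_topology_def openin_pullback_topology by auto
    then show "\<forall>\<^sub>F n in net. F n \<in> U"
      using topological_tendstoD[OF lim V(1)] U by auto
  qed
qed

end

(* Suppose the conclusion fails. Then h = f - x0s satisfies h a < h x0 for some a (h x0 may be
   infinite). With d the distance to the segment K = [a, x0], Ekeland's principle applied to
   h + \<kappa> |. - x0| + l d on a neighbourhood of K where h is bounded below gives a point c \<noteq> x0 that is
   a local minimum of f + g, where
     g y = - x0s y + \<kappa> |y - x0| + l d y + (\<kappa>/2) |y - c|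
   is convex and continuous, so (P2) applies directly. Testing the subgradient -ys of g at c against
   the single direction x0 - c gives (ys - x0s) (c - x0) \<le> - (\<kappa>/2) |c - x0| < 0. On the other hand
   ys is the weak-star limit of subgradients of f at points converging to c; such sequences are
   bounded, so the monotone relation passes to the limit and gives (ys - x0s) (c - x0) \<ge> 0. *)
theory Submission
  imports Defs
begin

section \<open>Uniform boundedness principle\<close>

text \<open>By Baire, one of the closed sets \<open>A k\<close> contains a ball of radius
  \<open>e\<close> about some \<open>x\<close>. Any nonzero direction, rescaled to length
  \<open>e\<close>, is the difference of two points of that ball, which gives the bound
  \<open>2 * real k / e\<close>.\<close>

lemma banach_steinhaus:
  fixes F :: "nat \<Rightarrow> 'a::banach \<Rightarrow>\<^sub>L 'b::real_normed_vector"
  assumes bdd: "\<And>x. bounded (range (\<lambda>n. blinfun_apply (F n) x))"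
  shows "bounded (range F)"
proof -
  define A where "A k = {x. \<forall>n. norm (F n x) \<le> real k}" for k
  have A_Inter: "A k = (\<Inter>n. {x. norm (F n x) \<le> real k})" for k
    by (auto simp: A_def)
  have closed_A: "closed (A k)" for k
    unfolding A_Inter by (intro closed_INT ballI closed_Collect_le continuous_intros)
  have "x \<in> (\<Union>k. A k)" for x
  proof -
    obtain B where "\<And>n. norm (F n x) \<le> B"
      using bdd[of x] by (auto simp: bounded_iff)
    moreover obtain k where "B \<le> real k"
      using real_arch_simple by blast
    ultimately show ?thesis
      by (auto simp: A_def intro: order_trans)
  qed
  then have "euclidean interior_of \<Union>(range A) \<noteq> {}"
    by (metis UNIV_eq_I UNIV_not_empty euclidean_interior_of interior_UNIV)
  then have "\<exists>k. interior (A k) \<noteq> {}"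
    using Baire_category_alt[of "euclidean :: 'a topology" "range A"] closed_A
    by (auto simp: completely_metrizable_space_euclidean)
  then obtain k x where "x \<in> interior (A k)"
    by blast
  then obtain e where e: "e > 0" "cball x e \<subseteq> A k"
    by (meson mem_interior_cball)
  have "norm (F n) \<le> 2 * real k / e" for n
  proof (rule norm_blinfun_bound)
    fix v
    show "norm (F n v) \<le> 2 * real k / e * norm v"
    proof (cases "v = 0")
      case False
      define w where "w = (e / norm v) *\<^sub>R v"
      have "x \<in> A k" "x + w \<in> A k"
        using e False by (auto intro!: subsetD[OF e(2)] simp: w_def dist_norm)
      then have "norm (F n x) \<le> real k" "norm (F n (x + w)) \<le> real k"
        by (auto simp: A_def)
      then have "norm (F n (x + w) - F n x) \<le> 2 * real k"
        using norm_triangle_ineq4[of "F n (x + w)" "F n x"] by linarith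
      then have "e / norm v * norm (F n v) \<le> 2 * real k"
        using e False by (simp add: w_def blinfun.add_right blinfun.scaleR_right)
      then show ?thesis
        using e False by (simp add: field_simps)
    qed simp
  qed (use e in simp)
  then show ?thesis
    by (auto simp: bounded_iff)
qed

section \<open>Ekeland's principle on a complete metric space\<close>

text \<open>Lower semicontinuity enters as closedness of the sublevel sets inside \<open>A\<close>.
  A sequence whose every step closes at least half of the gap to the infimum still reachable is
  Cauchy, since its steps are paid for by the decrease of \<open>\<phi>\<close>; its limit is
  \<open>c\<close>.\<close>

lemma ekeland_variational_principle:
  fixes \<phi> :: "'a::complete_space \<Rightarrow> real"
  assumes closed: "\<And>r. closed {x \<in> A. \<phi> x \<le> r}"
    and bdd: "bdd_below (\<phi> ` A)" and a: "a \<in> A" and \<epsilon>: "\<epsilon> > 0"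
  obtains c where "c \<in> A" "\<phi> c + \<epsilon> * dist a c \<le> \<phi> a"
    "\<And>y. y \<in> A \<Longrightarrow> \<phi> c \<le> \<phi> y + \<epsilon> * dist c y"
proof -
  \<comment> \<open>The order behind the principle: passing from \<open>x\<close> to
    \<open>y\<close> costs \<open>\<epsilon>\<close> per unit of distance, to be covered by the
    decrease of \<open>\<phi>\<close>.\<close>
  define R where "R x y \<longleftrightarrow> y \<in> A \<and> \<phi> y + \<epsilon> * dist x y \<le> \<phi> x" for x y
  have R_trans: "R x z" if "R x y" "R y z" for x y z
  proof -
    have "\<epsilon> * dist x z \<le> \<epsilon> * dist x y + \<epsilon> * dist y z"
      using \<epsilon> dist_triangle[of x z y] by (simp flip: distrib_left)
    then show ?thesis
      using that by (auto simp: R_def)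
  qed
  have R_le: "\<phi> y \<le> \<phi> x" if "R x y" for x y
    using that \<epsilon> by (auto simp: R_def) (smt (verit) mult_nonneg_nonneg zero_le_dist)
  \<comment> \<open>The inequality over all \<open>z\<close> puts \<open>\<phi> y\<close> at or
    below the midpoint of \<open>\<phi> x\<close> and the infimum over the successors of
    \<open>x\<close>. If that infimum is already \<open>\<phi> x\<close>, then \<open>x\<close>
    itself serves.\<close>
  have step: "\<exists>y. y \<in> A \<and> (R x y \<and> (\<forall>z. R x z \<longrightarrow> 2 * \<phi> y \<le> \<phi> x + \<phi> z))" if "x \<in> A" for x
  proof -
    define I where "I = Inf (\<phi> ` {z. R x z})"
    have Rxx: "R x x"
      using that by (simp add: R_def)
    have bddx: "bdd_below (\<phi> ` {z. R x z})"
      by (rule bdd_below_mono[OF bdd]) (auto simp: R_def)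
    have I_le: "I \<le> \<phi> z" if "R x z" for z
      unfolding I_def using that bddx by (intro cInf_lower) auto
    show ?thesis
    proof (cases "I = \<phi> x")
      case True
      then show ?thesis
        using that Rxx I_le by (intro exI[of _ x]) auto
    next
      case False
      then have "I < (\<phi> x + I) / 2"
        using I_le[OF Rxx] by auto
      then obtain y where "R x y" "\<phi> y < (\<phi> x + I) / 2"
        unfolding I_def using Rxx bddx by (subst (asm) cInf_less_iff) auto
      then show ?thesis
        using I_le by (intro exI[of _ y]) (fastforce simp: R_def)
    qed
  qed
  have "\<exists>X. \<forall>n. (X n \<in> A \<and> (n = 0 \<longrightarrow> X n = a)) \<and>
      (R (X n) (X (Suc n)) \<and> (\<forall>z. R (X n) z \<longrightarrow> 2 * \<phi> (X (Suc n)) \<le> \<phi> (X n) + \<phi> z))"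
    by (rule dependent_nat_choice) (use a step in auto)
  then obtain X where X0: "X 0 = a" and XA: "\<And>n. X n \<in> A"
    and RX: "\<And>n. R (X n) (X (Suc n))"
    and half: "\<And>n z. R (X n) z \<Longrightarrow> 2 * \<phi> (X (Suc n)) \<le> \<phi> (X n) + \<phi> z"
    by metis
  have RX_le: "R (X m) (X n)" if "m \<le> n" for m n
    using that
  proof (induction rule: dec_induct)
    case base
    show ?case using XA by (simp add: R_def)
  next
    case (step n)
    then show ?case using RX R_trans by blast
  qed
  have dec: "decseq (\<lambda>n. \<phi> (X n))"
    unfolding decseq_def using RX_le R_le by blast
  obtain B where B: "\<And>x. x \<in> A \<Longrightarrow> B \<le> \<phi> x"
    using bdd by (auto simp: bdd_below_def)
  obtain L where L: "(\<lambda>n. \<phi> (X n)) \<longlonglongrightarrow> L" and L_le: "\<And>n. L \<le> \<phi> (X n)"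
    using decseq_convergent[OF dec, of B] B XA by metis
  have "Cauchy X"
  proof (rule metric_CauchyI)
    fix e :: real assume "e > 0"
    then have "\<forall>\<^sub>F n in sequentially. \<phi> (X n) < L + \<epsilon> * e / 2"
      using \<epsilon> by (intro order_tendstoD(2)[OF L]) auto
    then obtain N where N: "\<phi> (X N) < L + \<epsilon> * e / 2"
      by (auto simp: eventually_sequentially)
    have near: "dist (X N) (X n) < e / 2" if "n \<ge> N" for n
    proof -
      have "\<epsilon> * dist (X N) (X n) < \<epsilon> * (e / 2)"
        using RX_le[OF that] L_le[of n] N by (auto simp: R_def)
      then show ?thesis using \<epsilon> by simp
    qed
    then show "\<exists>M. \<forall>m\<ge>M. \<forall>n\<ge>M. dist (X m) (X n) < e"
      by (meson dist_triangle_half_r)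
  qed
  then obtain c where c: "X \<longlonglongrightarrow> c"
    using Cauchy_convergent convergent_def by blast
  have Rc: "R (X n) c" for n
  proof -
    have lim: "(\<lambda>m. \<phi> (X n) - \<epsilon> * dist (X n) (X m)) \<longlonglongrightarrow> \<phi> (X n) - \<epsilon> * dist (X n) c"
      by (intro tendsto_intros c)
    \<comment> \<open>Closedness concerns a fixed level, whereas the bound on
      \<open>\<phi> (X m)\<close> varies with \<open>m\<close>; the slack \<open>e\<close> provides
      one level valid for all large \<open>m\<close>.\<close>
    have sub: "c \<in> A \<and> \<phi> c \<le> \<phi> (X n) - \<epsilon> * dist (X n) c + e" if "e > 0" for e
    proof -
      have "\<forall>\<^sub>F m in sequentially.
          \<phi> (X n) - \<epsilon> * dist (X n) (X m) < \<phi> (X n) - \<epsilon> * dist (X n) c + e"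
        using that by (intro order_tendstoD(2)[OF lim]) auto
      moreover have "\<forall>\<^sub>F m in sequentially. \<phi> (X m) + \<epsilon> * dist (X n) (X m) \<le> \<phi> (X n)"
        using eventually_ge_at_top[of n] by eventually_elim (use RX_le in \<open>auto simp: R_def\<close>)
      ultimately have "\<forall>\<^sub>F m in sequentially.
          X m \<in> {x \<in> A. \<phi> x \<le> \<phi> (X n) - \<epsilon> * dist (X n) c + e}"
        by eventually_elim (use XA in auto)
      then have "c \<in> {x \<in> A. \<phi> x \<le> \<phi> (X n) - \<epsilon> * dist (X n) c + e}"
        by (rule Lim_in_closed_set[OF closed _ _ c]) simp
      then show ?thesis by simp
    qed
    have "c \<in> A" using sub[of 1] by simp
    moreover have "\<phi> c \<le> \<phi> (X n) - \<epsilon> * dist (X n) c"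
      by (rule field_le_epsilon) (use sub in blast)
    ultimately show ?thesis by (simp add: R_def)
  qed
  show thesis
  proof
    show "c \<in> A" "\<phi> c + \<epsilon> * dist a c \<le> \<phi> a"
      using Rc[of 0] X0 by (auto simp: R_def)
    fix y assume "y \<in> A"
    show "\<phi> c \<le> \<phi> y + \<epsilon> * dist c y"
    proof (rule ccontr)
      \<comment> \<open>A violating \<open>y\<close> is a successor of every \<open>X n\<close>, so
        halving yields \<open>L \<le> \<phi> y\<close> in the limit, against
        \<open>\<phi> y < \<phi> c \<le> L\<close>.\<close>
      assume neg: "\<not> \<phi> c \<le> \<phi> y + \<epsilon> * dist c y"
      then have "R c y"
        using \<open>y \<in> A\<close> by (auto simp: R_def)
      then have "2 * \<phi> (X (Suc n)) \<le> \<phi> (X n) + \<phi> y" for n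
        using half Rc R_trans by blast
      moreover have "(\<lambda>n. 2 * \<phi> (X (Suc n))) \<longlonglongrightarrow> 2 * L" "(\<lambda>n. \<phi> (X n) + \<phi> y) \<longlonglongrightarrow> L + \<phi> y"
        by (intro tendsto_intros LIMSEQ_Suc L)+
      ultimately have "2 * L \<le> L + \<phi> y"
        by (meson LIMSEQ_le)
      moreover have "\<phi> c \<le> L"
        using LIMSEQ_le_const[OF L] R_le[OF Rc] by blast
      moreover have "\<epsilon> * dist c y \<ge> 0"
        using \<epsilon> by simp
      ultimately show False using neg by linarith
    qed
  qed
qed

section \<open>Distance to a compact set and lower semicontinuity\<close>

lemma infdist_compact_attained:
  fixes K :: "'a::metric_space set"
  assumes "compact K" "K \<noteq> {}"
  obtains p where "p \<in> K" "infdist x K = dist x p"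
proof -
  obtain p where p: "p \<in> K" "\<And>q. q \<in> K \<Longrightarrow> dist x p \<le> dist x q"
    using continuous_attains_inf[OF assms, of "dist x"]
      continuous_on_dist[OF continuous_on_const continuous_on_id]
    by blast
  have "infdist x K = dist x p"
    using p assms by (intro antisym infdist_le) (auto simp: infdist_notempty intro!: cINF_greatest)
  then show thesis using that p by blast
qed

text \<open>The convex combination of nearest points lies in \<open>K\<close>, so it bounds the
  distance at the combined point.\<close>

lemma convex_on_infdist:
  fixes K :: "'a::real_normed_vector set"
  assumes "compact K" "convex K" "K \<noteq> {}" "convex S"
  shows "convex_on S (\<lambda>x. infdist x K)"
proof (rule convex_onI)
  fix t :: real and x y assume t: "0 < t" "t < 1"
  obtain p where p: "p \<in> K" "infdist x K = dist x p"
    using infdist_compact_attained[OF assms(1,3)] .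
  obtain q where q: "q \<in> K" "infdist y K = dist y q"
    using infdist_compact_attained[OF assms(1,3)] .
  have "(1 - t) *\<^sub>R p + t *\<^sub>R q \<in> K"
    using convexD_alt[OF assms(2) p(1) q(1)] t by simp
  then have "infdist ((1 - t) *\<^sub>R x + t *\<^sub>R y) K
      \<le> norm ((1 - t) *\<^sub>R (x - p) + t *\<^sub>R (y - q))"
    by (rule infdist_le[THEN order_trans]) (simp add: dist_norm algebra_simps)
  also have "\<dots> \<le> (1 - t) * infdist x K + t * infdist y K"
    using norm_triangle_ineq[of "(1 - t) *\<^sub>R (x - p)" "t *\<^sub>R (y - q)"] t
    by (simp add: p q dist_norm)
  finally show "infdist ((1 - t) *\<^sub>R x + t *\<^sub>R y) K \<le> (1 - t) * infdist x K + t * infdist y K" .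
qed fact

lemma lower_semicontinuous_add_continuous:
  assumes lsc: "lower_semicontinuous f" and f: "never_minus_infinity f"
    and g: "continuous_on UNIV g"
  shows "lower_semicontinuous (\<lambda>x. f x + ereal (g x))"
  unfolding lower_semicontinuous_def
proof (intro allI impI)
  fix x a assume a: "a < f x + ereal (g x)"
  have fin: "f y \<noteq> -\<infinity>" for y
    using f by (auto simp: never_minus_infinity_def)
  show "\<forall>\<^sub>F y in nhds x. a < f y + ereal (g y)"
  proof (cases a)
    case (real r)
    then have "ereal (r - g x) < f x"
      using a fin[of x] by (cases "f x") auto
    \<comment> \<open>Such an \<open>s\<close> splits the bound: near \<open>x\<close>,
      \<open>f y > s\<close> and \<open>g y > r - s\<close> add up to
      \<open>f y + g y > r\<close>.\<close>
    then obtain s where s: "ereal (r - g x) < ereal s" "ereal s < f x"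
      using ereal_dense2 by blast
    have "(g \<longlongrightarrow> g x) (nhds x)"
      using g by (metis UNIV_I continuous_on_def tendsto_at_iff_tendsto_nhds)
    then have "\<forall>\<^sub>F y in nhds x. r - s < g y"
      using s by (intro order_tendstoD(1)) auto
    moreover have "\<forall>\<^sub>F y in nhds x. ereal s < f y"
      using lsc s by (auto simp: lower_semicontinuous_def)
    ultimately show ?thesis
    proof eventually_elim
      case (elim y)
      then show ?case
        using fin[of y] real by (cases "f y") auto
    qed
  qed (use a fin in \<open>auto intro!: always_eventually\<close>)
qed

lemma open_lower_semicontinuous:
  assumes "lower_semicontinuous f"
  shows "open {x. r < f x}"
  unfolding open_subopen[of "{x. r < f x}"]
proof
  fix x assume "x \<in> {x. r < f x}"
  then have "\<forall>\<^sub>F y in nhds x. r < f y"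
    using assms by (auto simp: lower_semicontinuous_def)
  then show "\<exists>T. open T \<and> x \<in> T \<and> T \<subseteq> {x. r < f x}"
    by (auto simp: eventually_nhds)
qed

text \<open>The open sets \<open>?V n\<close> increase with \<open>n\<close> and cover
  \<open>K\<close>, so by compactness one of them contains \<open>K\<close>, and with it a uniform
  neighbourhood of \<open>K\<close>.\<close>

lemma lower_semicontinuous_bounded_near_compact:
  fixes f :: "'a::metric_space \<Rightarrow> ereal"
  assumes lsc: "lower_semicontinuous f" and f: "never_minus_infinity f"
    and "compact K" "K \<noteq> {}"
  obtains \<delta> B where "\<delta> > 0" "\<And>x. infdist x K \<le> \<delta> \<Longrightarrow> ereal B \<le> f x"
proof -
  let ?V = "\<lambda>n. {x. ereal (- real n) < f x}"
  have cover: "K \<subseteq> (\<Union>n. ?V n)"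
  proof
    fix x assume "x \<in> K"
    have "- \<infinity> < f x" using f by (simp add: never_minus_infinity_def)
    then obtain r where r: "ereal r < f x" using ereal_dense2 by blast
    obtain n where "- r \<le> real n" using real_arch_simple by blast
    then have "ereal (- real n) \<le> ereal r" by simp
    then show "x \<in> (\<Union>n. ?V n)" using r le_less_trans by blast
  qed
  obtain C where C: "finite C" "K \<subseteq> (\<Union>n\<in>C. ?V n)"
    by (rule compactE_image[OF assms(3) open_lower_semicontinuous[OF lsc] cover])
  define N where "N = Max (insert 0 C)"
  have "?V n \<subseteq> ?V N" if "n \<in> C" for n
  proof -
    have "n \<le> N" using C that by (simp add: N_def)
    then have "ereal (- real N) \<le> ereal (- real n)" by simp
    then show ?thesis by (blast intro: le_less_trans)
  qed
  then have "K \<subseteq> ?V N" using C by blast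
  then obtain e where e: "e > 0" "(\<Union>x\<in>K. ball x e) \<subseteq> ?V N"
    using compact_subset_open_imp_ball_epsilon_subset[OF assms(3) open_lower_semicontinuous[OF lsc]]
    by blast
  show thesis
  proof
    show "e / 2 > 0" using e by simp
    fix x assume x: "infdist x K \<le> e / 2"
    obtain p where "p \<in> K" "infdist x K = dist x p"
      using infdist_compact_attained[OF assms(3,4)] .
    then have "x \<in> (\<Union>x\<in>K. ball x e)"
      using x e by (intro UN_I[of p]) (auto simp: dist_commute)
    then have "ereal (- real N) < f x" using e(2) by blast
    then show "ereal (- real N) \<le> f x" by simp
  qed
qed

section \<open>Local minima of a penalized function away from a given point\<close>

text \<open>Ekeland's principle is run near \<open>K\<close>, on the points not above the penalized
  value at \<open>a\<close>. By \<open>lt\<close> the point \<open>b\<close>, where the penalties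
  vanish, lies above that level and is excluded. A steep distance penalty keeps \<open>c\<close>
  inside the region where \<open>h\<close> is bounded below, so the minimum is local in the whole
  space.\<close>

lemma penalized_local_minimum:
  fixes h :: "'a::complete_space \<Rightarrow> ereal"
  assumes lsc: "lower_semicontinuous h" and h: "never_minus_infinity h"
    and K: "compact K" "a \<in> K" "b \<in> K" and lt: "h a + ereal (\<kappa> * dist b a) < h b"
    and \<epsilon>: "\<epsilon> > 0" and \<kappa>: "\<kappa> \<ge> 0"
  obtains c l where "c \<noteq> b" "h c < \<infinity>" "l \<ge> 0"
    "local_minimum (\<lambda>y. h y + ereal (\<kappa> * dist b y + l * infdist y K + \<epsilon> * dist c y)) c"
proof -
  have K0: "K \<noteq> {}" using K by auto
  have fin: "h y \<noteq> -\<infinity>" for y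
    using h by (auto simp: never_minus_infinity_def)
  obtain \<delta> B where \<delta>: "\<delta> > 0" and B: "\<And>x. infdist x K \<le> \<delta> \<Longrightarrow> ereal B \<le> h x"
    using lower_semicontinuous_bounded_near_compact[OF lsc h K(1) K0] by blast
  obtain ra where ra: "h a = ereal ra"
    using lt fin[of a] by (cases "h a") auto
  define s where "s = ra + \<kappa> * dist b a"
  \<comment> \<open>l is so large that the penalty keeps the minimizer off the boundary infdist y K = \<delta>.\<close>
  define l where "l = max 0 ((s - B + 1) / \<delta>)"
  have l: "l \<ge> 0" "s < B + l * \<delta>"
  proof -
    have "(s - B + 1) / \<delta> * \<delta> \<le> l * \<delta>"
      using \<delta> by (intro mult_right_mono) (auto simp: l_def)
    then show "s < B + l * \<delta>" using \<delta> by simp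
  qed (simp add: l_def)
  define g where "g y = \<kappa> * dist b y + l * infdist y K" for y
  define F where "F y = h y + ereal (g y)" for y
  have g0: "g y \<ge> 0" for y
    using l \<kappa> by (simp add: g_def infdist_nonneg)
  have lscF: "lower_semicontinuous F"
    unfolding F_def g_def
    by (intro lower_semicontinuous_add_continuous lsc h continuous_intros)
  \<comment> \<open>Cutting at the level \<open>s\<close> makes \<open>F\<close> finite on
    \<open>A\<close>, so the real-valued principle applies. A point near \<open>K\<close> outside
    \<open>A\<close> has a value above \<open>s\<close>, hence above \<open>F c\<close>, and cannot
    spoil minimality.\<close>
  define A where "A = {y. infdist y K \<le> \<delta> \<and> F y \<le> ereal s}"
  have Fa: "F a = ereal s"
    using K by (simp add: F_def g_def ra s_def)
  have FA: "F y = ereal (real_of_ereal (F y))" if "y \<in> A" for y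
    using that fin[of y] by (cases "h y") (auto simp: A_def F_def)
  have closed: "closed {x \<in> A. real_of_ereal (F x) \<le> r}" for r
  proof -
    have "{x \<in> A. real_of_ereal (F x) \<le> r}
        = {y. infdist y K \<le> \<delta>} \<inter> - {y. ereal (min r s) < F y}"
    proof (intro set_eqI)
      fix y
      show "y \<in> {x \<in> A. real_of_ereal (F x) \<le> r} \<longleftrightarrow>
          y \<in> {y. infdist y K \<le> \<delta>} \<inter> - {y. ereal (min r s) < F y}"
        using fin[of y] by (cases "h y") (auto simp: A_def F_def min_def)
    qed
    moreover have "closed {y. infdist y K \<le> \<delta>}"
      by (intro closed_Collect_le continuous_intros)
    ultimately show ?thesis
      using open_lower_semicontinuous[OF lscF] by (simp add: closed_Int closed_Compl)
  qed
  have lowF: "ereal (B + g y) \<le> F y" if "infdist y K \<le> \<delta>" for y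
    using B[OF that] by (cases "h y") (auto simp: F_def)
  have "B \<le> real_of_ereal (F y)" if "y \<in> A" for y
  proof -
    have "ereal (B + g y) \<le> ereal (real_of_ereal (F y))"
      using lowF[of y] FA[OF that] that by (auto simp: A_def)
    then show ?thesis using g0[of y] by simp
  qed
  then have bdd: "bdd_below ((\<lambda>y. real_of_ereal (F y)) ` A)"
    by (auto simp: bdd_below_def)
  have aA: "a \<in> A" using K \<delta> Fa by (simp add: A_def)
  obtain c where c: "c \<in> A"
    and min: "\<And>y. y \<in> A \<Longrightarrow> real_of_ereal (F c) \<le> real_of_ereal (F y) + \<epsilon> * dist c y"
    using ekeland_variational_principle[OF closed bdd aA \<epsilon>] by metis
  have Fc: "F c \<le> ereal s" using c by (simp add: A_def)
  have min': "F c \<le> F y + ereal (\<epsilon> * dist c y)" if "infdist y K \<le> \<delta>" for y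
  proof (cases "y \<in> A")
    case True
    then show ?thesis
      using min[OF True] FA[OF True] FA[OF c] by (metis ereal_less_eq(3) plus_ereal.simps(1))
  next
    case False
    then have "F c \<le> F y" using Fc that by (auto simp: A_def)
    also have "F y \<le> F y + ereal (\<epsilon> * dist c y)"
      using \<epsilon> by (intro ereal_le_add_self) simp
    finally show ?thesis .
  qed
  have "infdist c K < \<delta>"
  proof (rule ccontr)
    assume "\<not> infdist c K < \<delta>"
    then have "infdist c K = \<delta>" using c by (simp add: A_def)
    then have "ereal (B + g c) \<le> ereal s" using lowF[of c] Fc by (metis order.refl order_trans)
    moreover have "l * \<delta> \<le> g c"
      using \<open>infdist c K = \<delta>\<close> \<kappa> by (simp add: g_def)
    ultimately show False using l by simp
  qed
  then have "\<forall>\<^sub>F y in nhds c. infdist y K < \<delta>"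
    by (intro eventually_nhds_in_open[of "{y. infdist y K < \<delta>}" c, simplified]
        open_Collect_less continuous_intros)
  then have "\<forall>\<^sub>F y in nhds c. F c \<le> F y + ereal (\<epsilon> * dist c y)"
    by eventually_elim (simp add: min')
  then have "local_minimum (\<lambda>y. h y + ereal (\<kappa> * dist b y + l * infdist y K + \<epsilon> * dist c y)) c"
    by (simp add: local_minimum_def F_def g_def add.assoc)
  moreover have "c \<noteq> b"
  proof
    assume "c = b"
    then have "h b \<le> ereal s" using Fc K by (simp add: F_def g_def flip: zero_ereal_def)
    then show False using lt by (simp add: ra s_def)
  qed
  moreover have "h c < \<infinity>"
    using FA[OF c] by (cases "h c") (auto simp: F_def)
  ultimately show thesis using that l by blast
qed

section \<open>Pairing of weak-star and norm limits\<close>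

text \<open>Split \<open>yn n (y n)\<close> as \<open>yn n (y n - c) + yn n c\<close>. The first
  term tends to 0 because uniform boundedness makes the functionals norm bounded; the second
  converges pointwise.\<close>

lemma weak_star_limit_pairing:
  fixes yn :: "nat \<Rightarrow> 'a::banach \<Rightarrow>\<^sub>L real"
  assumes lim: "limitin weak_star_topology yn ys sequentially" and y: "y \<longlonglongrightarrow> c"
  shows "(\<lambda>n. blinfun_apply (yn n) (y n)) \<longlonglongrightarrow> blinfun_apply ys c"
proof -
  have pt: "(\<lambda>n. yn n v) \<longlonglongrightarrow> ys v" for v
    using lim by (simp add: limitin_weak_star_iff)
  have "bounded (range yn)"
    by (rule banach_steinhaus) (use convergent_imp_bounded pt in blast)
  then have "Bseq yn"
    by (simp add: Bseq_eq_bounded)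
  moreover have "(\<lambda>n. y n - c) \<longlonglongrightarrow> 0"
    using y by (simp add: LIM_zero)
  ultimately have "(\<lambda>n. yn n (y n - c)) \<longlonglongrightarrow> 0"
    by (simp add: tendsto_Zfun_iff blinfun.Bfun_prod_Zfun)
  from tendsto_add[OF this pt[of c]] show ?thesis
    by (simp add: blinfun.diff_right)
qed

section \<open>Optimality against the monotone relation\<close>

theorem theorem6:
  fixes D :: "'a::banach subdifferential"
    and f :: "'a \<Rightarrow> ereal"
    and x0 :: 'a and x0s :: "'a \<Rightarrow>\<^sub>L real"
  assumes "feasible_subdifferential D"
    and "proper_function f"
    and "lower_semicontinuous f"
    and "in_monotone_relation x0 x0s (D f)"
  shows "x0s \<in> fenchel_subdifferential f x0"
proof (rule ccontr)
  assume neg: "x0s \<notin> fenchel_subdifferential f x0"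
  have f: "never_minus_infinity f" and dom: "effective_domain f \<noteq> {}"
    using assms(2) by (auto simp: proper_function_def)
  have fin: "f y \<noteq> -\<infinity>" for y
    using f by (auto simp: never_minus_infinity_def)
  define h where "h y = f y + ereal (- x0s y)" for y
  have hfin: "h y \<noteq> -\<infinity>" for y
    using fin[of y] by (cases "f y") (auto simp: h_def)
  have h: "never_minus_infinity h"
    using hfin by (simp add: never_minus_infinity_def)
  have lsc: "lower_semicontinuous h"
    unfolding h_def by (intro lower_semicontinuous_add_continuous assms f continuous_intros)
  \<comment> \<open>The subgradient inequality can fail in two ways: \<open>f x0\<close> is finite
    and some point violates it, or \<open>f x0\<close> is infinite and any point of the domain,
    which is nonempty, will do.\<close>
  obtain a where a: "h a < h x0"
  proof (cases "x0 \<in> effective_domain f")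
    case True
    then obtain a where "\<not> ereal (x0s (a - x0)) \<le> f a - f x0"
      using neg by (auto simp: fenchel_subdifferential_def fenchel_subdifferential_on_def)
    then have "h a < h x0"
      using True fin[of a] fin[of x0]
      by (cases "f a"; cases "f x0")
        (auto simp: h_def effective_domain_def blinfun.diff_right)
    then show ?thesis using that by blast
  next
    case False
    moreover obtain a where "a \<in> effective_domain f"
      using dom by blast
    ultimately have "h a < h x0"
      using fin[of a] by (cases "f a") (auto simp: h_def effective_domain_def)
    then show ?thesis using that by blast
  qed
  then obtain r where r: "h a < ereal r" "ereal r < h x0"
    using ereal_dense2 by blast
  obtain ra where ra: "h a = ereal ra" using r hfin[of a] by (cases "h a") auto
  have ne: "dist x0 a > 0" using a by auto
  \<comment> \<open>The slope for which \<open>h a + \<kappa> * dist x0 a\<close> equals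
    \<open>r\<close>. The intermediate real \<open>r\<close> keeps the slope finite even if
    \<open>h x0\<close> is infinite.\<close>
  define \<kappa> where "\<kappa> = (r - ra) / dist x0 a"
  have \<kappa>: "\<kappa> > 0" using r ne by (simp add: \<kappa>_def ra)
  have "h a + ereal (\<kappa> * dist x0 a) < h x0"
    using r ne by (simp add: \<kappa>_def ra)
  \<comment> \<open>The segment is compact, as the penalization demands, and convex, so that the
    distance to it is convex. The perturbation \<open>\<kappa> / 2\<close> is chosen smaller than
    the slope \<open>\<kappa>\<close>.\<close>
  then obtain c l where cb: "c \<noteq> x0" and hc: "h c < \<infinity>" and l: "l \<ge> 0"
    and min: "local_minimum (\<lambda>y. h y + ereal (\<kappa> * dist x0 y
                + l * infdist y (closed_segment a x0) + \<kappa> / 2 * dist c y)) c"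
    using penalized_local_minimum[of h "closed_segment a x0" a x0 \<kappa> "\<kappa> / 2"] lsc h \<kappa> by auto
  \<comment> \<open>The tilt by \<open>x0s\<close> moves from \<open>h\<close> into
    \<open>g\<close>, so that \<open>f + g\<close> is the minimized function and \<open>g\<close> is
    finite, convex and continuous everywhere.\<close>
  define g where "g y = - x0s y + \<kappa> * dist x0 y + l * infdist y (closed_segment a x0)
                + \<kappa> / 2 * dist c y" for y
  have "convex_on UNIV (\<lambda>y. - x0s y)"
    by (simp add: convex_on_def blinfun.add_right blinfun.scaleR_right)
  then have "convex_on UNIV g"
    unfolding g_def using \<kappa> l
    by (intro convex_on_add convex_on_cmul convex_on_dist convex_on_infdist) auto
  moreover have "continuous_on UNIV g"
    unfolding g_def by (intro continuous_intros)
  ultimately have conv: "convex_continuous_near UNIV c (\<lambda>y. ereal (g y))"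
    by (simp add: convex_continuous_near_def continuous_on_ereal)
  have "f y + ereal (g y) = h y + ereal (\<kappa> * dist x0 y
                + l * infdist y (closed_segment a x0) + \<kappa> / 2 * dist c y)" for y
    by (cases "f y") (auto simp: h_def g_def)
  then have "local_minimum (\<lambda>y. f y + ereal (g y)) c"
    using min by simp
  moreover have "c \<in> effective_domain f"
    using hc by (cases "f c") (auto simp: h_def effective_domain_def)
  moreover have gfin: "never_minus_infinity (\<lambda>y. ereal (g y))"
    by (simp add: never_minus_infinity_def)
  ultimately have "0 \<in> D (\<lambda>y. ereal (g y)) c + limsup_subdifferential D f c"
    using assms(1,3) f conv unfolding feasible_subdifferential_def by blast
  moreover have "D (\<lambda>y. ereal (g y)) c = fenchel_subdifferential_on UNIV (\<lambda>y. ereal (g y)) c"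
    using assms(1) gfin conv unfolding feasible_subdifferential_def by blast
  ultimately obtain p ys where p: "p \<in> fenchel_subdifferential_on UNIV (\<lambda>y. ereal (g y)) c"
    and ys: "ys \<in> limsup_subdifferential D f c" and sum: "0 = p + ys"
    by (auto elim: set_plus_elim)
  \<comment> \<open>At \<open>x0\<close> both the \<open>\<kappa>\<close> term and the segment
    distance vanish, while the perturbation costs \<open>\<kappa> / 2 * dist x0 c\<close>. Half of
    the gain \<open>\<kappa> * dist x0 c\<close> survives, and the segment penalty at
    \<open>c\<close> has the favourable sign.\<close>
  have "p (x0 - c) \<le> g x0 - g c"
    using p by (auto simp: fenchel_subdifferential_on_def)
  moreover have "p = - ys"
    using sum by (simp add: eq_neg_iff_add_eq_0)
  moreover have "l * infdist c (closed_segment a x0) \<ge> 0"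
    using l by (simp add: infdist_nonneg)
  ultimately have upper: "ys (c - x0) - x0s (c - x0) \<le> - (\<kappa> / 2) * dist x0 c"
    by (simp add: g_def dist_commute blinfun.diff_right blinfun.minus_left algebra_simps)
  obtain y yn where yn: "\<And>n. yn n \<in> D f (y n)" and y: "y \<longlonglongrightarrow> c"
    and lim: "limitin weak_star_topology yn ys sequentially"
    using ys by (auto simp: limsup_subdifferential_def)
  have y': "(\<lambda>n. y n - x0) \<longlonglongrightarrow> c - x0"
    by (intro tendsto_intros y)
  have "(\<lambda>n. yn n (y n - x0) - x0s (y n - x0)) \<longlonglongrightarrow> ys (c - x0) - x0s (c - x0)"
    by (intro tendsto_diff weak_star_limit_pairing[OF lim] blinfun.tendsto tendsto_const y')
  moreover have "yn n (y n - x0) - x0s (y n - x0) \<ge> 0" for n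
    using assms(4) yn[of n] by (auto simp: in_monotone_relation_def blinfun.diff_left)
  ultimately have "ys (c - x0) - x0s (c - x0) \<ge> 0"
    by (intro LIMSEQ_le_const) auto
  moreover have "\<kappa> / 2 * dist x0 c > 0"
    using \<kappa> cb by simp
  ultimately show False using upper by linarith
qed

end
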